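(* Consider the pair of homogeneous multifold feasibility problems (FP)-(FD) described in the context. Then $$R^0\subseteq \tilde R:=\bigl\{j\in J : A_j^\top K_j^+\cap \operatorname{Lin}(A^\top K^+)=A_j^\top K_j^+\cap \operatorname{Lin}(\overline{A^\top K^+})\bigr\}.$$
   Context: Let $J=\{1,\dots,r\}$. For each $j\in J$ let $K_j\subset\mathbb{R}^{q_j}$ ($q_j\ge1$) be a closed convex regular cone (regular: nonempty interior and pointed, i.e. containing no lines) and $A_j\in\mathbb{R}^{q_j\times n}$ a matrix. Put $K=K_1\times\cdots\times K_r$ and let $A$ be the matrix obtained by stacking $A_1,\dots,A_r$ vertically. For a set $Q\subseteq\mathbb{R}^m$, $Q^+=\{y\in\mathbb{R}^m: y^\top z\ge0\ \forall z\in Q\}$; thus $K^+=K_1^+\times\cdots\times K_r^+$. We write $A_j^\top K_j^+=\{A_j^\top u: u\in K_j^+\}$ and $A^\top K^+=\{\sum_{j=1}^r A_j^\top y_j: y_j\in K_j^+\}$. An overline denotes closure, and $\operatorname{Lin}Q$ denotes the lineality space of a convex set $Q$ (for a convex cone $Q$ containing $0$, $\operatorname{Lin}Q=Q\cap(-Q)$). The problems are: (FP) find $x\in\mathbb{R}^n$ with $A_jx\in K_j$ for all $j\in J$; (FD) find $y=(y_1,\dots,y_r)$ with $\sum_{j=1}^r A_j^\top y_j=0$ and $y_j\in K_j^+$ for all $j\in J$. Let $S$ be the set of pairs $(x,y)$ with $A_jx\in K_j$, $y_j\in K_j^+$, $y_j^\top A_jx=0$ for all $j\in J$, and $A^\top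 y=0$. Define $$R^0=\{j\in J:\exists (x,y)\in S,\ -y_j\in\operatorname{ri}N_{K_j}(A_jx)\},$$ where $\operatorname{ri}$ is relative interior and $N_{K_j}(s)=\{v: v^\top(z-s)\le0\ \forall z\in K_j\}=-(K_j^+\cap s^\perp)$ is the normal cone to $K_j$ at $s\in K_j$. *)

theory Defs
  imports "HOL-Analysis.Analysis"
begin

text \<open>
  The product \<open>\<real>^(q\<^sub>1) \<times> \<dots> \<times> \<real>^(q\<^sub>r)\<close> is the type \<^typ>\<open>real ^ 'm\<close>, whose coordinates are
  partitioned by a map \<open>b :: 'm \<Rightarrow> nat\<close> with range \<open>{1..r}\<close>: coordinate \<open>i\<close> belongs to the
  factor \<open>b i\<close>, and \<open>q\<^sub>j = card {i. b i = j} \<ge> 1\<close>. The factor \<open>\<real>^(q\<^sub>j)\<close> is identified with the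
  coordinate subspace \<open>block_space b j\<close>. Topological, dual and normal notions
  that depend on the ambient space are taken relative to this subspace.
\<close>

definition block_space :: "('m::finite \<Rightarrow> nat) \<Rightarrow> nat \<Rightarrow> (real ^ 'm) set" where
  "block_space b j = {v. \<forall>i. b i \<noteq> j \<longrightarrow> v $ i = 0}"

text \<open>
  For a stacked vector \<open>y :: real ^ 'm\<close> this is the component \<open>y\<^sub>j\<close>; for a stacked matrix
  \<open>A :: real ^ 'n ^ 'm\<close> (whose components are its rows) it is the block of rows \<open>A\<^sub>j\<close>. The
  rows outside block \<open>j\<close> are set to zero.
\<close>

definition block :: "('m::finite \<Rightarrow> nat) \<Rightarrow> nat \<Rightarrow> 'a::zero ^ 'm \<Rightarrow> 'a ^ 'm" where
  "block b j v = (\<chi> i. if b i = j then v $ i else 0)"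

definition contains_line :: "'a::real_vector set \<Rightarrow> bool" where
  "contains_line Q \<longleftrightarrow> (\<exists>a d. d \<noteq> 0 \<and> (\<forall>t::real. a + t *\<^sub>R d \<in> Q))"

text \<open>In the next three definitions \<open>V\<close> is the ambient linear space.\<close>

definition closed_convex_regular_cone :: "'a::euclidean_space set \<Rightarrow> 'a set \<Rightarrow> bool" where
  "closed_convex_regular_cone V Q \<longleftrightarrow>
     Q \<subseteq> V \<and> closed Q \<and> convex Q \<and> cone Q \<and>
     (top_of_set V) interior_of Q \<noteq> {} \<and> \<not> contains_line Q"

definition dual_cone :: "'a::real_inner set \<Rightarrow> 'a set \<Rightarrow> 'a set" where
  "dual_cone V Q = {y \<in> V. \<forall>z\<in>Q. 0 \<le> y \<bullet> z}"

definition normal_cone :: "'a::real_inner set \<Rightarrow> 'a set \<Rightarrow> 'a \<Rightarrow> 'a set" where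
  "normal_cone V Q s = {v \<in> V. \<forall>z\<in>Q. v \<bullet> (z - s) \<le> 0}"

definition lineality_space :: "'a::real_vector set \<Rightarrow> 'a set" where
  "lineality_space Q = {d. \<forall>x\<in>Q. \<forall>t::real. x + t *\<^sub>R d \<in> Q}"

lemma lineality_space_convex_cone:
  assumes "convex Q" "cone Q" "0 \<in> Q"
  shows "lineality_space Q = Q \<inter> uminus ` Q"
proof (intro equalityI subsetI)
  fix d assume "d \<in> lineality_space Q"
  then have *: "0 + t *\<^sub>R d \<in> Q" for t :: real
    using assms(3) unfolding lineality_space_def by blast
  have "d \<in> Q" "- d \<in> Q"
    using *[of 1] *[of "-1"] by simp_all
  then show "d \<in> Q \<inter> uminus ` Q"
    by (metis IntI image_eqI minus_minus)
next
  fix d assume "d \<in> Q \<inter> uminus ` Q"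
  then have d: "d \<in> Q" "- d \<in> Q" by auto
  have "t *\<^sub>R d \<in> Q" for t :: real
    using d assms(2) mem_cone[of Q d t] mem_cone[of Q "- d" "- t"] by (cases "0 \<le> t") auto
  then show "d \<in> lineality_space Q"
    using assms(1,2) convex_cone[of Q] unfolding lineality_space_def by auto
qed

text \<open>The set \<open>A\<^sub>j\<^sup>T K\<^sub>j\<^sup>+\<close>.\<close>

definition block_dual_image ::
    "('m::finite \<Rightarrow> nat) \<Rightarrow> (nat \<Rightarrow> (real ^ 'm) set) \<Rightarrow> real ^ 'n ^ 'm \<Rightarrow> nat \<Rightarrow> (real ^ 'n) set" where
  "block_dual_image b K A j =
     {transpose (block b j A) *v u | u. u \<in> dual_cone (block_space b j) (K j)}"

text \<open>The set \<open>A\<^sup>T K\<^sup>+\<close>.\<close>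

definition dual_image ::
    "nat \<Rightarrow> ('m::finite \<Rightarrow> nat) \<Rightarrow> (nat \<Rightarrow> (real ^ 'm) set) \<Rightarrow> real ^ 'n ^ 'm \<Rightarrow> (real ^ 'n) set" where
  "dual_image r b K A =
     {(\<Sum>j=1..r. transpose (block b j A) *v block b j y) | y.
        \<forall>j\<in>{1..r}. block b j y \<in> dual_cone (block_space b j) (K j)}"

definition complementary_solutions ::
    "nat \<Rightarrow> ('m::finite \<Rightarrow> nat) \<Rightarrow> (nat \<Rightarrow> (real ^ 'm) set) \<Rightarrow> real ^ 'n ^ 'm
      \<Rightarrow> ((real ^ 'n) \<times> (real ^ 'm)) set" where
  "complementary_solutions r b K A =
     {(x, y). (\<forall>j\<in>{1..r}. block b j A *v x \<in> K j \<and>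
                block b j y \<in> dual_cone (block_space b j) (K j) \<and>
                block b j y \<bullet> (block b j A *v x) = 0) \<and>
              transpose A *v y = 0}"

definition R_zero ::
    "nat \<Rightarrow> ('m::finite \<Rightarrow> nat) \<Rightarrow> (nat \<Rightarrow> (real ^ 'm) set) \<Rightarrow> real ^ 'n ^ 'm \<Rightarrow> nat set" where
  "R_zero r b K A =
     {j \<in> {1..r}. \<exists>(x, y) \<in> complementary_solutions r b K A.
        - block b j y \<in> rel_interior (normal_cone (block_space b j) (K j) (block b j A *v x))}"

definition R_tilde ::
    "nat \<Rightarrow> ('m::finite \<Rightarrow> nat) \<Rightarrow> (nat \<Rightarrow> (real ^ 'm) set) \<Rightarrow> real ^ 'n ^ 'm \<Rightarrow> nat set" where
  "R_tilde r b K A =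
     {j \<in> {1..r}.
        block_dual_image b K A j \<inter> lineality_space (dual_image r b K A) =
        block_dual_image b K A j \<inter> lineality_space (closure (dual_image r b K A))}"

end

theory Submission
  imports Defs
begin

text \<open>
  The inclusion has content in one direction only: a vector \<open>w = A\<^sub>j\<^sup>T u\<close>, \<open>u \<in> K\<^sub>j\<^sup>+\<close>, in the
  lineality space of the closure of \<open>A\<^sup>T K\<^sup>+\<close> must be shown to lie in that of \<open>A\<^sup>T K\<^sup>+\<close> itself. Let \<open>(x, y)\<close>
  witness \<open>j \<in> R\<^sup>0\<close>. The primal solution \<open>x\<close> is nonnegative on \<open>A\<^sup>T K\<^sup>+\<close>, hence on its closure,
  hence zero on the lineality space of the closure. So \<open>0 = w \<bullet> x = u \<bullet> A\<^sub>j x\<close>, which puts \<open>-u\<close>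
  in the normal cone to \<open>K\<^sub>j\<close> at \<open>A\<^sub>j x\<close>. Because \<open>-y\<^sub>j\<close> is a relative interior point of that
  cone, the segment from \<open>-u\<close> to \<open>-y\<^sub>j\<close> can be prolonged beyond \<open>-y\<^sub>j\<close> inside it: for some
  \<open>e > 1\<close> the vector \<open>e y\<^sub>j - (e - 1) u\<close> still lies in \<open>K\<^sub>j\<^sup>+\<close>. Replacing the \<open>j\<close>-th component of
  \<open>e y\<close> by it gives a point of \<open>K\<^sup>+\<close> whose image under \<open>A\<^sup>T\<close> is \<open>-(e - 1) w\<close>, as \<open>A\<^sup>T y = 0\<close>.
  Hence both \<open>w\<close> and \<open>-w\<close> belong to the convex cone \<open>A\<^sup>T K\<^sup>+\<close> itself.

  The orthogonality \<open>x \<bullet> w = 0\<close> is \<open>lineality_space_closure_orthogonal\<close>, and the prolongation is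
  \<open>normal_cone_prolongation\<close>. Changing one component of \<open>y\<close> is convenient once \<open>A\<^sup>T K\<^sup>+\<close> is the
  image of one product cone under one linear map, which is \<open>dual_image_eq\<close>.
\<close>

section \<open>Dual and normal cones\<close>

lemma dual_cone_nonneg_combination:
  assumes "subspace V" "u \<in> dual_cone V Q" "v \<in> dual_cone V Q" "0 \<le> s" "0 \<le> t"
  shows "s *\<^sub>R u + t *\<^sub>R v \<in> dual_cone V Q"
  using assms by (auto simp: dual_cone_def inner_add_left subspace_add subspace_scale)

lemma zero_in_dual_cone: "subspace V \<Longrightarrow> 0 \<in> dual_cone V Q"
  by (simp add: dual_cone_def subspace_0)

lemma convex_normal_cone:
  assumes "subspace V"
  shows "convex (normal_cone V Q s)"
proof (rule convexI)
  fix x y and u v :: real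
  assume xy: "x \<in> normal_cone V Q s" "y \<in> normal_cone V Q s" and uv: "0 \<le> u" "0 \<le> v"
  have "u * (x \<bullet> (z - s)) + v * (y \<bullet> (z - s)) \<le> 0" if "z \<in> Q" for z
    using xy uv that by (auto simp: normal_cone_def intro!: add_nonpos_nonpos mult_nonneg_nonpos)
  then show "u *\<^sub>R x + v *\<^sub>R y \<in> normal_cone V Q s"
    using xy assms by (simp add: normal_cone_def inner_add_left subspace_add subspace_scale)
qed

text \<open>
  For a convex cone, \<open>s + z\<close> stays in \<open>Q\<close> for every \<open>z \<in> Q\<close>, so testing the normal cone
  inequality at \<open>s + z\<close> turns it into the dual cone inequality at \<open>z\<close>.
\<close>

lemma uminus_normal_cone_in_dual_cone:
  assumes "subspace V" "convex Q" "cone Q" "s \<in> Q" "v \<in> normal_cone V Q s"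
  shows "- v \<in> dual_cone V Q"
proof -
  have "v \<bullet> z \<le> 0" if "z \<in> Q" for z
  proof -
    have "s + z \<in> Q"
      using assms(2-4) that convex_cone[of Q] by blast
    then have "v \<bullet> ((s + z) - s) \<le> 0"
      using assms(5) unfolding normal_cone_def by blast
    then show ?thesis by simp
  qed
  then show ?thesis
    using assms(1,5) by (auto simp: dual_cone_def normal_cone_def subspace_neg)
qed

lemma uminus_in_normal_cone:
  assumes "subspace V" "u \<in> dual_cone V Q" "u \<bullet> s = 0"
  shows "- u \<in> normal_cone V Q s"
  using assms by (auto simp: dual_cone_def normal_cone_def subspace_neg inner_diff_right)

text \<open>
  A dual vector \<open>u\<close> orthogonal to \<open>s\<close> gives the point \<open>-u\<close> of the normal cone at \<open>s\<close>, and a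
  segment ending in the relative interior of a convex set can be prolonged within that set.
\<close>

lemma normal_cone_prolongation:
  fixes Q :: "'a::euclidean_space set"
  assumes V: "subspace V" and Q: "convex Q" "cone Q" "s \<in> Q"
    and y: "- y \<in> rel_interior (normal_cone V Q s)"
    and u: "u \<in> dual_cone V Q" "u \<bullet> s = 0"
  obtains e where "1 < e" "e *\<^sub>R y + (1 - e) *\<^sub>R u \<in> dual_cone V Q"
proof -
  have "- u \<in> affine hull normal_cone V Q s"
    using uminus_in_normal_cone[OF V u] by (rule hull_inc)
  then obtain e where e: "1 < e" "(1 - e) *\<^sub>R (- u) + e *\<^sub>R (- y) \<in> normal_cone V Q s"
    using convex_rel_interior_if[OF convex_normal_cone[OF V] y] by blast
  have "- ((1 - e) *\<^sub>R (- u) + e *\<^sub>R (- y)) \<in> dual_cone V Q"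
    using uminus_normal_cone_in_dual_cone[OF V Q e(2)] .
  then have "e *\<^sub>R y + (1 - e) *\<^sub>R u \<in> dual_cone V Q"
    by (simp add: add.commute)
  with e(1) show thesis by (rule that)
qed

section \<open>Lineality spaces\<close>

lemma lineality_space_subset_closure:
  fixes Q :: "'a::real_normed_vector set"
  shows "lineality_space Q \<subseteq> lineality_space (closure Q)"
proof
  fix d assume d: "d \<in> lineality_space Q"
  have "x + t *\<^sub>R d \<in> closure Q" if "x \<in> closure Q" for x t
  proof -
    have "(+) (t *\<^sub>R d) ` Q \<subseteq> Q"
      using d by (auto simp: lineality_space_def add.commute)
    then have "(+) (t *\<^sub>R d) ` closure Q \<subseteq> closure Q"
      by (metis closure_mono closure_translation)
    then show ?thesis
      using that by (auto simp: add.commute)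
  qed
  then show "d \<in> lineality_space (closure Q)"
    by (simp add: lineality_space_def)
qed

text \<open>
  The origin moves along the whole line spanned by \<open>d\<close> within the closure, and a linear functional
  that is nonnegative on a line through the origin vanishes on it.
\<close>

lemma lineality_space_closure_orthogonal:
  fixes Q :: "'a::real_inner set"
  assumes "0 \<in> Q" "\<And>z. z \<in> Q \<Longrightarrow> 0 \<le> x \<bullet> z" "d \<in> lineality_space (closure Q)"
  shows "x \<bullet> d = 0"
proof -
  have "closure Q \<subseteq> {z. 0 \<le> x \<bullet> z}"
    using assms(2) closed_halfspace_ge[of 0 x] by (intro closure_minimal) auto
  moreover have "t *\<^sub>R d \<in> closure Q" for t
    using assms(1,3) closure_subset[of Q] by (force simp: lineality_space_def)
  ultimately have "0 \<le> x \<bullet> (t *\<^sub>R d)" for t by blast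
  from this[of 1] this[of "-1"] show ?thesis by simp
qed

section \<open>Blocks\<close>

lemma subspace_block_space: "subspace (block_space b j)"
  by (auto simp: subspace_def block_space_def)

lemma block_eq_self: "u \<in> block_space b j \<Longrightarrow> block b j u = u"
  by (auto simp: block_def block_space_def vec_eq_iff)

lemma block_other: "u \<in> block_space b j \<Longrightarrow> i \<noteq> j \<Longrightarrow> block b i u = 0"
  by (auto simp: block_def block_space_def vec_eq_iff)

lemma block_linear_combination:
  fixes y z :: "real ^ 'm::finite"
  shows "block b j (s *\<^sub>R y + t *\<^sub>R z) = s *\<^sub>R block b j y + t *\<^sub>R block b j z"
  by (auto simp: block_def vec_eq_iff)

lemma sum_block:
  fixes y :: "real ^ 'm::finite"
  assumes "range b = {1..r}"
  shows "(\<Sum>j=1..r. block b j y) = y"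
proof -
  have "b i \<in> {1..r}" for i using assms by blast
  then show ?thesis
    by (simp add: vec_eq_iff block_def sum.delta)
qed

text \<open>
  The row block \<open>A\<^sub>j\<close> enters only through this: on vectors supported in block \<open>j\<close>, the transposes
  of \<open>A\<^sub>j\<close> and \<open>A\<close> agree.
\<close>

lemma transpose_block_mult:
  fixes A :: "real ^ 'n::finite ^ 'm::finite"
  assumes "u \<in> block_space b j"
  shows "transpose (block b j A) *v u = transpose A *v u"
  using assms
  by (auto simp: vec_eq_iff matrix_vector_mult_def transpose_def block_def block_space_def
      intro!: sum.cong)

definition product_dual_cone ::
    "nat \<Rightarrow> ('m::finite \<Rightarrow> nat) \<Rightarrow> (nat \<Rightarrow> (real ^ 'm) set) \<Rightarrow> (real ^ 'm) set" where
  "product_dual_cone r b K =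
     {y. \<forall>j\<in>{1..r}. block b j y \<in> dual_cone (block_space b j) (K j)}"

lemma product_dual_cone_nonneg_combination:
  assumes "y \<in> product_dual_cone r b K" "z \<in> product_dual_cone r b K" "0 \<le> s" "0 \<le> t"
  shows "s *\<^sub>R y + t *\<^sub>R z \<in> product_dual_cone r b K"
  unfolding product_dual_cone_def mem_Collect_eq block_linear_combination
  using assms
  by (intro ballI dual_cone_nonneg_combination[OF subspace_block_space])
    (simp_all add: product_dual_cone_def)

lemma dual_cone_subset_product_dual_cone:
  assumes "j \<in> {1..r}" "u \<in> dual_cone (block_space b j) (K j)"
  shows "u \<in> product_dual_cone r b K"
proof -
  have u: "u \<in> block_space b j" using assms(2) by (simp add: dual_cone_def)
  have "block b i u \<in> dual_cone (block_space b i) (K i)" for i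
    using assms(2) block_eq_self[OF u] block_other[OF u]
      zero_in_dual_cone[OF subspace_block_space] by (cases "i = j") auto
  then show ?thesis by (simp add: product_dual_cone_def)
qed

lemma zero_in_product_dual_cone:
  fixes b :: "'a::finite \<Rightarrow> nat"
  shows "0 \<in> product_dual_cone r b K"
proof -
  have "block b j 0 = (0 :: real ^ 'a)" for j
    by (simp add: block_def vec_eq_iff)
  then show ?thesis
    by (simp add: product_dual_cone_def zero_in_dual_cone[OF subspace_block_space])
qed

lemma dual_image_eq:
  fixes A :: "real ^ 'n::finite ^ 'm::finite"
  assumes "range b = {1..r}"
  shows "dual_image r b K A = (\<lambda>y. transpose A *v y) ` product_dual_cone r b K"
proof -
  have "(\<Sum>j=1..r. transpose (block b j A) *v block b j y) = transpose A *v y" for y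
  proof -
    have "(\<Sum>j=1..r. transpose (block b j A) *v block b j y)
        = (\<Sum>j=1..r. transpose A *v block b j y)"
      by (intro sum.cong refl transpose_block_mult) (simp add: block_space_def block_def)
    also have "\<dots> = transpose A *v (\<Sum>j=1..r. block b j y)"
      by (simp add: linear_sum[OF matrix_vector_mul_linear])
    finally show ?thesis by (simp only: sum_block[OF assms])
  qed
  then show ?thesis
    by (auto simp: dual_image_def product_dual_cone_def)
qed

lemma lineality_space_dual_image:
  fixes A :: "real ^ 'n::finite ^ 'm::finite"
  assumes "range b = {1..r}"
  shows "lineality_space (dual_image r b K A)
    = dual_image r b K A \<inter> uminus ` dual_image r b K A"
proof -
  let ?C = "dual_image r b K A"
  have comb: "s *\<^sub>R v + t *\<^sub>R w \<in> ?C" if vw: "v \<in> ?C" "w \<in> ?C" and st: "0 \<le> s" "0 \<le> t" for v w s t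
  proof -
    from vw obtain y z where yz: "y \<in> product_dual_cone r b K" "z \<in> product_dual_cone r b K"
      and eq: "v = transpose A *v y" "w = transpose A *v z"
      unfolding dual_image_eq[OF assms] by blast
    have "s *\<^sub>R v + t *\<^sub>R w = transpose A *v (s *\<^sub>R y + t *\<^sub>R z)"
      by (simp add: eq matrix_vector_right_distrib matrix_vector_mult_scaleR)
    then show ?thesis
      using product_dual_cone_nonneg_combination[OF yz st] by (simp add: dual_image_eq[OF assms])
  qed
  have "0 \<in> ?C"
    using zero_in_product_dual_cone by (force simp: dual_image_eq[OF assms])
  moreover have "convex ?C"
    using comb by (auto intro: convexI)
  moreover have "cone ?C"
    unfolding cone_def using comb[where t = 0] by force
  ultimately show ?thesis
    by (intro lineality_space_convex_cone)
qed

section \<open>Weak duality and the inclusion\<close>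

lemma inner_transpose_mult:
  fixes M :: "real ^ 'n::finite ^ 'm::finite"
  shows "x \<bullet> (transpose M *v u) = u \<bullet> (M *v x)"
  using dot_lmul_matrix[of u M x] by (simp add: inner_commute)

text \<open>
  Weak duality: each summand \<open>x \<bullet> A\<^sub>j\<^sup>T y\<^sub>j = y\<^sub>j \<bullet> A\<^sub>j x\<close> pairs a vector of \<open>K\<^sub>j\<^sup>+\<close> with one of \<open>K\<^sub>j\<close>.
\<close>

lemma primal_solution_nonneg_on_dual_image:
  fixes A :: "real ^ 'n::finite ^ 'm::finite"
  assumes "\<And>j. j \<in> {1..r} \<Longrightarrow> block b j A *v x \<in> K j" "z \<in> dual_image r b K A"
  shows "0 \<le> x \<bullet> z"
proof -
  from assms(2) obtain y where
    y: "\<And>j. j \<in> {1..r} \<Longrightarrow> block b j y \<in> dual_cone (block_space b j) (K j)"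
    and z: "z = (\<Sum>j=1..r. transpose (block b j A) *v block b j y)"
    unfolding dual_image_def by blast
  have "x \<bullet> (transpose (block b j A) *v block b j y) = block b j y \<bullet> (block b j A *v x)" for j
    by (rule inner_transpose_mult)
  then have "x \<bullet> z = (\<Sum>j=1..r. block b j y \<bullet> (block b j A *v x))"
    by (simp add: z inner_sum_right)
  also have "0 \<le> \<dots>"
    using y assms(1) by (intro sum_nonneg) (auto simp: dual_cone_def)
  finally show ?thesis .
qed

theorem theorem6:
  fixes r :: nat
    and b :: "'m::finite \<Rightarrow> nat"
    and K :: "nat \<Rightarrow> (real ^ 'm) set"
    and A :: "real ^ 'n::finite ^ 'm"
  assumes "range b = {1..r}"
    and "\<And>j. j \<in> {1..r} \<Longrightarrow> closed_convex_regular_cone (block_space b j) (K j)"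
  shows "R_zero r b K A \<subseteq> R_tilde r b K A"
proof
  let ?C = "dual_image r b K A"
  fix j assume "j \<in> R_zero r b K A"
  then obtain x y where j: "j \<in> {1..r}"
    and sol: "(x, y) \<in> complementary_solutions r b K A"
    and ri: "- block b j y
      \<in> rel_interior (normal_cone (block_space b j) (K j) (block b j A *v x))"
    unfolding R_zero_def by blast
  have primal: "block b i A *v x \<in> K i" if "i \<in> {1..r}" for i
    using sol that by (simp add: complementary_solutions_def)
  have y: "y \<in> product_dual_cone r b K" and Ay: "transpose A *v y = 0"
    using sol by (simp_all add: complementary_solutions_def product_dual_cone_def)
  have Kj: "convex (K j)" "cone (K j)"
    using assms(2)[OF j] by (simp_all add: closed_convex_regular_cone_def)
  have "w \<in> lineality_space ?C"
    if w: "w \<in> block_dual_image b K A j" "w \<in> lineality_space (closure ?C)" for w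
  proof -
    from w(1) obtain u where u: "u \<in> dual_cone (block_space b j) (K j)"
      and w_block: "w = transpose (block b j A) *v u"
      unfolding block_dual_image_def by blast
    have u_block: "u \<in> block_space b j" using u by (simp add: dual_cone_def)
    have w_eq: "w = transpose A *v u"
      using w_block transpose_block_mult[OF u_block] by simp
    have "u \<in> product_dual_cone r b K"
      using dual_cone_subset_product_dual_cone[of j r u b K] j u by blast
    then have "w \<in> ?C"
      by (simp add: dual_image_eq[OF assms(1)] w_eq)

    have "0 \<in> ?C"
      using zero_in_product_dual_cone by (force simp: dual_image_eq[OF assms(1)])
    then have "x \<bullet> w = 0"
      using primal_solution_nonneg_on_dual_image[where K = K, OF primal] w(2)
      by (rule lineality_space_closure_orthogonal)
    then have "u \<bullet> (block b j A *v x) = 0"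
      by (simp add: w_block inner_transpose_mult del: transpose_matrix_vector)
    then obtain e where e: "1 < e"
      "e *\<^sub>R block b j y + (1 - e) *\<^sub>R u \<in> dual_cone (block_space b j) (K j)"
      using normal_cone_prolongation[OF subspace_block_space Kj primal[OF j] ri u] by blast

    \<comment> \<open>Outside block \<open>j\<close> the vector \<open>u\<close> vanishes, so subtracting a multiple of \<open>u\<close> from \<open>e y\<close>
      alters only the component controlled by the prolongation.\<close>
    define y' where "y' = e *\<^sub>R y + (1 - e) *\<^sub>R u"
    have "block b i y' \<in> dual_cone (block_space b i) (K i)" if i: "i \<in> {1..r}" for i
    proof (cases "i = j")
      case True
      then show ?thesis
        using e(2) by (simp add: y'_def block_linear_combination block_eq_self[OF u_block])
    next
      case False
      have "block b i y \<in> dual_cone (block_space b i) (K i)"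
        using y i by (simp add: product_dual_cone_def)
      from dual_cone_nonneg_combination[OF subspace_block_space this this, of e 0]
      show ?thesis
        using e(1) False by (simp add: y'_def block_linear_combination block_other[OF u_block])
    qed
    then have "y' \<in> product_dual_cone r b K"
      by (simp add: product_dual_cone_def)
    then have "(1 / (e - 1)) *\<^sub>R y' \<in> product_dual_cone r b K"
      using product_dual_cone_nonneg_combination[of y' r b K y' "1 / (e - 1)" 0] e(1) by simp
    moreover have "transpose A *v ((1 / (e - 1)) *\<^sub>R y') = - w"
    proof -
      have "transpose A *v y' = (1 - e) *\<^sub>R w"
        by (simp add: y'_def matrix_vector_right_distrib matrix_vector_mult_scaleR Ay w_eq
            del: transpose_matrix_vector)
      then have "transpose A *v ((1 / (e - 1)) *\<^sub>R y') = ((1 - e) / (e - 1)) *\<^sub>R w"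
        by (simp add: matrix_vector_mult_scaleR)
      also have "(1 - e) / (e - 1) = - 1"
        using e(1) by (simp add: field_simps)
      finally show ?thesis by simp
    qed
    ultimately have "- w \<in> ?C"
      unfolding dual_image_eq[OF assms(1)] by (metis image_eqI)
    with \<open>w \<in> ?C\<close> show ?thesis
      unfolding lineality_space_dual_image[OF assms(1)] by (metis IntI image_eqI minus_minus)
  qed
  then have "block_dual_image b K A j \<inter> lineality_space ?C
      = block_dual_image b K A j \<inter> lineality_space (closure ?C)"
    using lineality_space_subset_closure[of ?C] by blast
  then show "j \<in> R_tilde r b K A"
    using j by (simp add: R_tilde_def)
qed

end
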